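(* Let $L>0$, $\tau_1>0$, $a\ge0$, $b>0$. Let $V$ be the bounded solution of $$\tau_1V_t=V_{yy}-a^2(V-1)-2b\,\delta_0\,V\quad\text{in }\mathbf{R}\times(0,\infty)$$ with initial data $V_0\in C(\mathbf{R})\cap L^\infty(\mathbf{R})$. For $\varepsilon>0$ let $v^\varepsilon$ be the solution of $$\frac{\tau_1}{\varepsilon}v_t=\varepsilon v_{xx}-\frac{a^2(v-1)}{\varepsilon}-2b\,\delta_0\,v\quad\text{in }(-L,L)\times(0,\infty),$$ $$v_x(\pm L,t)=0\ (t>0),\qquad v(x,0)=v^\varepsilon_0(x)\ (x\in(-L,L)),$$ and set $V^\varepsilon(y,t)=v^\varepsilon(\varepsilon y,t)$ for $|y|\le L/\varepsilon$. Assume that $V^\varepsilon(\cdot,0)\in C([-L/\varepsilon,L/\varepsilon])$ converges to $V_0$ in the sense that $$\lim_{\varepsilon\downarrow0}\ \sup_{|x|\le L/\varepsilon}\left|V^\varepsilon(x,0)-V_0(x)\right|=0.$$ Then $V^\varepsilon$ converges to $V$ locally uniformly in $\mathbf{R}\times[0,\infty)$ as $\varepsilon\downarrow0$. In particular, $v^\varepsilon$ converges to $1$ locally uniformly in $\left((-L,L)\setminus\{0\}\right)\times[0,\infty)$, and $\xi^\varepsilon(t)=v^\varepsilon(0,t)$ converges to $\xi(t)=V(0,t)$ locally uniformly in $[0,\infty)$.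
   Context: $\delta_0$ denotes the Dirac delta at the origin and the equations are understood in the distributional sense (i.e. solutions are continuous across the origin, solve the equation without the delta term away from the origin, and satisfy the jump conditions $V_y(0+,t)-V_y(0-,t)=2bV(0,t)$ and $\varepsilon(v_x(0+,t)-v_x(0-,t))=2b\,v(0,t)$, respectively).
   Formalization: The claim that v^ε converges to 1 locally uniformly off the origin is proved under the extra assumption V_0(y)→1 as |y|→∞; without it the claim fails (a=0, V_0=V=v^ε=0), and convergence at t=0 forces it. *)

theory Defs
  imports "HOL-Analysis.Analysis"
begin

text \<open>
  Solutions on \<open>J \<times> [0,\<infinity>)\<close>, with \<open>J\<close> a closed interval having the origin in its interior, of
  \<open>c u\<^sub>t = D u\<^sub>x\<^sub>x - k (u - 1) - 2 b \<delta>\<^sub>0 u\<close>. The delta term is read as continuity of \<open>u\<close> across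
  the origin, the equation without that term for \<open>x \<noteq> 0\<close>, and the jump condition
  \<open>D (u\<^sub>x(0+,t) - u\<^sub>x(0-,t)) = 2 b u(0,t)\<close>. Continuity holds up to \<open>t = 0\<close> and up to the end
  points of \<open>J\<close>; boundary and initial conditions are not part of the definition.
\<close>

definition delta_sol ::
    "real \<Rightarrow> real \<Rightarrow> real \<Rightarrow> real \<Rightarrow> real set \<Rightarrow> (real \<Rightarrow> real \<Rightarrow> real) \<Rightarrow> bool" where
  "delta_sol c D k b J u \<longleftrightarrow>
     continuous_on (J \<times> {0..}) (\<lambda>(x, t). u x t) \<and>
     (\<exists>ut ux uxx :: real \<Rightarrow> real \<Rightarrow> real.
        (\<forall>x \<in> interior J - {0}. \<forall>t > 0.
           ((\<lambda>s. u x s) has_real_derivative ut x t) (at t) \<and>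
           ((\<lambda>z. u z t) has_real_derivative ux x t) (at x) \<and>
           ((\<lambda>z. ux z t) has_real_derivative uxx x t) (at x) \<and>
           c * ut x t = D * uxx x t - k * (u x t - 1)) \<and>
        (\<forall>t > 0. \<exists>p m.
           ((\<lambda>x. ux x t) \<longlongrightarrow> p) (at_right 0) \<and>
           ((\<lambda>x. ux x t) \<longlongrightarrow> m) (at_left 0) \<and>
           D * (p - m) = 2 * b * u 0 t))"

text \<open>The end point derivatives are one-sided.\<close>

definition neumann_bc :: "real \<Rightarrow> (real \<Rightarrow> real \<Rightarrow> real) \<Rightarrow> bool" where
  "neumann_bc L u \<longleftrightarrow>
     (\<forall>t > 0. ((\<lambda>x. u x t) has_real_derivative 0) (at L within {-L..L}) \<and>
              ((\<lambda>x. u x t) has_real_derivative 0) (at (-L) within {-L..L}))"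

definition locally_uniform_limit ::
    "'a::topological_space set \<Rightarrow> ('i \<Rightarrow> 'a \<Rightarrow> 'b::metric_space) \<Rightarrow> ('a \<Rightarrow> 'b) \<Rightarrow> 'i filter \<Rightarrow> bool" where
  "locally_uniform_limit S f l F \<longleftrightarrow>
     (\<forall>K. compact K \<and> K \<subseteq> S \<longrightarrow> uniform_limit K f l F)"

end

theory Submission
  imports Defs
begin

text \<open>
  Everything follows from the parabolic maximum principle on a bounded interval. The barrier
  \<open>N + M ((x - x\<^sub>0)\<^sup>2 + K t)\<close> is a strict supersolution of \<open>c w\<^sub>t = D w\<^sub>x\<^sub>x\<close> once \<open>c K > 2 D\<close>, and its
  slope points strictly outwards at the end points, so that it also beats homogeneous Neumann data.
  In the original variable \<open>c = \<tau>\<^sub>1/\<epsilon>\<close> and \<open>D = \<epsilon>\<close>, so \<open>K = 3 \<epsilon>\<^sup>2/\<tau>\<^sub>1\<close> is admissible. This barrier bounds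
  \<open>v\<^sup>\<epsilon>\<close> uniformly in \<open>\<epsilon>\<close> first. Centred at the origin it then bounds \<open>v\<^sup>\<epsilon> - V(x/\<epsilon>, t)\<close> by the initial
  error plus a multiple of \<open>x\<^sup>2 + \<epsilon>\<^sup>2 t = \<epsilon>\<^sup>2 (y\<^sup>2 + t)\<close>, and centred at a point \<open>x\<^sub>0 \<noteq> 0\<close> it bounds
  \<open>v\<^sup>\<epsilon>(x\<^sub>0, t) - 1\<close> by the initial error near \<open>x\<^sub>0\<close> plus a multiple of \<open>\<epsilon>\<^sup>2 t\<close>.
\<close>

section \<open>Subsolutions and the maximum principle\<close>

text \<open>
  Only the set where \<open>w > 0\<close> is constrained: there the zeroth order term of the equation has a sign
  and can be dropped, and the jump at the origin excludes a maximum.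
\<close>

definition sub_sol :: "real \<Rightarrow> real \<Rightarrow> real \<Rightarrow> real \<Rightarrow> (real \<Rightarrow> real \<Rightarrow> real) \<Rightarrow> bool" where
  "sub_sol c D A B w \<longleftrightarrow>
     continuous_on ({A..B} \<times> {0..}) (\<lambda>(x, t). w x t) \<and>
     (\<exists>wt wx wxx :: real \<Rightarrow> real \<Rightarrow> real.
        (\<forall>x \<in> {A<..<B} - {0}. \<forall>t > 0.
           ((\<lambda>s. w x s) has_real_derivative wt x t) (at t) \<and>
           ((\<lambda>z. w z t) has_real_derivative wx x t) (at x) \<and>
           ((\<lambda>z. wx z t) has_real_derivative wxx x t) (at x) \<and>
           (w x t > 0 \<longrightarrow> c * wt x t \<le> D * wxx x t)) \<and>
        (A < 0 \<and> 0 < B \<longrightarrow> (\<forall>t > 0. \<exists>p m.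
           ((\<lambda>x. wx x t) \<longlongrightarrow> p) (at_right 0) \<and>
           ((\<lambda>x. wx x t) \<longlongrightarrow> m) (at_left 0) \<and>
           (w 0 t > 0 \<longrightarrow> m < p))))"

lemma sub_solI:
  assumes "continuous_on ({A..B} \<times> {0..}) (\<lambda>(x, t). w x t)"
    and "\<And>x t. x \<in> {A<..<B} - {0} \<Longrightarrow> t > 0 \<Longrightarrow>
           ((\<lambda>s. w x s) has_real_derivative wt x t) (at t) \<and>
           ((\<lambda>z. w z t) has_real_derivative wx x t) (at x) \<and>
           ((\<lambda>z. wx z t) has_real_derivative wxx x t) (at x) \<and>
           (w x t > 0 \<longrightarrow> c * wt x t \<le> D * wxx x t)"
    and "\<And>t. A < 0 \<Longrightarrow> 0 < B \<Longrightarrow> t > 0 \<Longrightarrow> \<exists>p m.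
           ((\<lambda>x. wx x t) \<longlongrightarrow> p) (at_right 0) \<and>
           ((\<lambda>x. wx x t) \<longlongrightarrow> m) (at_left 0) \<and> (w 0 t > 0 \<longrightarrow> m < p)"
  shows "sub_sol c D A B w"
  using assms unfolding sub_sol_def by blast

text \<open>If \<open>l > 0\<close>, then \<open>g\<close>, which vanishes at the maximum, is
  positive just to the right of \<open>x\<close>, and \<open>f\<close> climbs above its maximum. The
  second derivative enters at the single point \<open>x\<close> only, matching the pointwise
  derivatives supplied by \<open>sub_sol\<close>.\<close>

lemma local_max_second_derivative_nonpos:
  fixes f g :: "real \<Rightarrow> real"
  assumes d: "d > 0"
    and max: "\<And>y. \<bar>y - x\<bar> < d \<Longrightarrow> f y \<le> f x"
    and f: "\<And>y. \<bar>y - x\<bar> < d \<Longrightarrow> (f has_real_derivative g y) (at y)"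
    and g: "(g has_real_derivative l) (at x)"
  shows "l \<le> 0"
proof (rule ccontr)
  assume "\<not> l \<le> 0"
  then have "l > 0" by simp
  have "g x = 0"
    by (rule DERIV_local_max[OF f d]) (use d max in \<open>auto simp: abs_minus_commute\<close>)
  obtain e where e: "e > 0" "\<And>h. h > 0 \<Longrightarrow> h < e \<Longrightarrow> g x < g (x + h)"
    using has_real_derivative_pos_inc_right[OF g \<open>l > 0\<close>] by auto
  define h where "h = min d e / 2"
  have h: "0 < h" "h < d" "h < e" using d e(1) by (auto simp: h_def)
  have "f x < f (x + h)"
  proof (rule DERIV_pos_imp_increasing_open[where f = f])
    show "\<exists>y. (f has_real_derivative y) (at z) \<and> 0 < y" if "x < z" "z < x + h" for z
      using that f[of z] e(2)[of "z - x"] h \<open>g x = 0\<close> by (intro exI[of _ "g z"]) auto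
    show "continuous_on {x..x + h} f"
      by (intro continuous_at_imp_continuous_on ballI DERIV_isCont[OF f]) (use h in auto)
  qed (use h in auto)
  with max[of "x + h"] h show False by auto
qed

text \<open>Excludes a maximum at the origin when the slope jumps upwards there. The function need
  not be differentiable at 0: a positive limit slope on the right, or a negative one on the left,
  would make \<open>f\<close> exceed \<open>f 0\<close> nearby.\<close>

lemma local_max_one_sided_derivatives:
  fixes f g :: "real \<Rightarrow> real"
  assumes AB: "A < 0" "0 < B"
    and max: "\<And>y. y \<in> {A..B} \<Longrightarrow> f y \<le> f 0"
    and cont: "continuous_on {A..B} f"
    and f: "\<And>y. y \<in> {A<..<B} - {0} \<Longrightarrow> (f has_real_derivative g y) (at y)"
    and p: "(g \<longlongrightarrow> p) (at_right 0)" and m: "(g \<longlongrightarrow> m) (at_left 0)"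
  shows "p \<le> m"
proof -
  have "p \<le> 0"
  proof (rule ccontr)
    assume "\<not> p \<le> 0"
    then have "\<forall>\<^sub>F y in at_right 0. 0 < g y" using order_tendstoD(1)[OF p] by auto
    then obtain e where e: "e > 0" "\<And>y. 0 < y \<Longrightarrow> y < e \<Longrightarrow> 0 < g y"
      unfolding eventually_at_right_field by auto
    define h where "h = min B e / 2"
    have h: "0 < h" "h < B" "h < e" using AB e(1) by (auto simp: h_def)
    have "f 0 < f h"
    proof (rule DERIV_pos_imp_increasing_open[where f = f])
      show "\<exists>y. (f has_real_derivative y) (at z) \<and> 0 < y" if "0 < z" "z < h" for z
        using that f[of z] e(2)[of z] h AB by (intro exI[of _ "g z"]) auto
      show "continuous_on {0..h} f"
        by (rule continuous_on_subset[OF cont]) (use h AB in auto)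
    qed (use h in auto)
    with max[of h] h AB show False by auto
  qed
  moreover have "0 \<le> m"
  proof (rule ccontr)
    assume "\<not> 0 \<le> m"
    then have "\<forall>\<^sub>F y in at_left 0. g y < 0" using order_tendstoD(2)[OF m] by auto
    then obtain e where e: "e < 0" "\<And>y. e < y \<Longrightarrow> y < 0 \<Longrightarrow> g y < 0"
      unfolding eventually_at_left_field by auto
    define h where "h = max A e / 2"
    have h: "h < 0" "A < h" "e < h" using AB e(1) by (auto simp: h_def)
    have "f 0 < f h"
    proof (rule DERIV_neg_imp_decreasing_open[where f = f])
      show "\<exists>y. (f has_real_derivative y) (at z) \<and> y < 0" if "h < z" "z < 0" for z
        using that f[of z] e(2)[of z] h AB by (intro exI[of _ "g z"]) auto
      show "continuous_on {h..0} f"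
        by (rule continuous_on_subset[OF cont]) (use h AB in auto)
    qed (use h in auto)
    with max[of h] h AB show False by auto
  qed
  ultimately show ?thesis by simp
qed

text \<open>A positive maximum of \<open>w\<close> minus the barrier is ruled out at time 0 by
  \<open>init\<close>, at the end points by \<open>bdry\<close>, at the origin by the jump, and
  elsewhere by strictness of the supersolution. The alternative in \<open>bdry\<close> serves two
  uses: Neumann data on the whole interval, and a mere bound on the values on a smaller
  window.\<close>

lemma sub_sol_le_barrier:
  fixes w :: "real \<Rightarrow> real \<Rightarrow> real"
  assumes w: "sub_sol c D A B w"
    and pos: "c > 0" "D > 0" "M > 0" "N \<ge> 0" "2 * D < c * K"
    and x0: "A < x0" "x0 < B"
    and init: "\<And>x. x \<in> {A..B} \<Longrightarrow> w x 0 \<le> N + M * (x - x0)\<^sup>2"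
    and bdry: "\<And>x t. x \<in> {A, B} \<Longrightarrow> t \<in> {0<..T} \<Longrightarrow> w x t \<le> N + M * (x - x0)\<^sup>2 \<or>
                 ((\<lambda>x. w x t) has_real_derivative 0) (at x within {A..B})"
    and xt: "x \<in> {A..B}" "t \<in> {0..T}"
  shows "w x t \<le> N + M * ((x - x0)\<^sup>2 + K * t)"
proof (rule ccontr)
  define z where "z = (\<lambda>x t. w x t - (N + M * ((x - x0)\<^sup>2 + K * t)))"
  assume "\<not> ?thesis"
  then have zxt: "z x t > 0" by (simp add: z_def)
  have K: "K > 0" using pos by (smt (verit) zero_less_mult_iff)
  obtain wt wx wxx where
      int: "\<And>x t. x \<in> {A<..<B} - {0} \<Longrightarrow> t > 0 \<Longrightarrow>
           ((\<lambda>s. w x s) has_real_derivative wt x t) (at t) \<and>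
           ((\<lambda>z. w z t) has_real_derivative wx x t) (at x) \<and>
           ((\<lambda>z. wx z t) has_real_derivative wxx x t) (at x) \<and>
           (w x t > 0 \<longrightarrow> c * wt x t \<le> D * wxx x t)"
      and jump: "\<And>t. A < 0 \<Longrightarrow> 0 < B \<Longrightarrow> t > 0 \<Longrightarrow> \<exists>p m.
           ((\<lambda>x. wx x t) \<longlongrightarrow> p) (at_right 0) \<and>
           ((\<lambda>x. wx x t) \<longlongrightarrow> m) (at_left 0) \<and>
           (w 0 t > 0 \<longrightarrow> m < p)"
      and cont: "continuous_on ({A..B} \<times> {0..}) (\<lambda>(x, t). w x t)"
    using w unfolding sub_sol_def by blast
  have contz: "continuous_on ({A..B} \<times> {0..}) (\<lambda>(x, t). z x t)"
    using cont unfolding z_def split_def by (intro continuous_intros) auto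
  have "\<exists>q\<in>{A..B} \<times> {0..T}. \<forall>r\<in>{A..B} \<times> {0..T}. (\<lambda>(x, t). z x t) r \<le> (\<lambda>(x, t). z x t) q"
  proof (rule continuous_attains_sup)
    show "compact ({A..B} \<times> {0..T})" by (intro compact_Times compact_Icc)
    show "continuous_on ({A..B} \<times> {0..T}) (\<lambda>(x, t). z x t)"
      by (rule continuous_on_subset[OF contz]) auto
  qed (use xt in auto)
  then obtain \<xi> \<sigma> where \<xi>: "\<xi> \<in> {A..B}" and \<sigma>: "\<sigma> \<in> {0..T}"
    and max: "\<And>x t. x \<in> {A..B} \<Longrightarrow> t \<in> {0..T} \<Longrightarrow> z x t \<le> z \<xi> \<sigma>" by auto
  have zpos: "z \<xi> \<sigma> > 0" using zxt max[OF xt] by simp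
  have "\<sigma> \<noteq> 0"
    using init[OF \<xi>] zpos by (auto simp: z_def)
  then have \<sigma>0: "\<sigma> > 0" using \<sigma> by simp
  \<comment> \<open>Strictness defeats the first alternative of \<open>bdry\<close>. As the right
    side is nonnegative, it also places the maximum where \<open>w > 0\<close>, the only region in
    which \<open>sub_sol\<close> gives inequalities.\<close>
  have wbig: "w \<xi> \<sigma> > N + M * (\<xi> - x0)\<^sup>2"
    using zpos mult_pos_pos[OF pos(3) mult_pos_pos[OF K \<sigma>0]]
    by (simp add: z_def distrib_left)
  then have wpos: "w \<xi> \<sigma> > 0"
    using pos by (smt (verit) mult_nonneg_nonneg zero_le_power2)
  have "\<xi> \<noteq> A"
  proof
    assume eq: "\<xi> = A"
    then have "((\<lambda>x. w x \<sigma>) has_real_derivative 0) (at A within {A..B})"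
      using bdry[of A \<sigma>] \<sigma> \<sigma>0 wbig by auto
    \<comment> \<open>The barrier decreases from \<open>A\<close> towards \<open>x0\<close> while
      \<open>w\<close> has slope 0, so \<open>z\<close> strictly increases into the interval. The
      end point \<open>B\<close> is the mirror image.\<close>
    then have "((\<lambda>x. z x \<sigma>) has_real_derivative 2 * M * (x0 - A)) (at A within {A..B})"
      unfolding z_def by (auto intro!: derivative_eq_intros simp: algebra_simps)
    from has_real_derivative_pos_inc_right[OF this] pos x0
    obtain d where d: "d > 0" "\<And>h. h > 0 \<Longrightarrow> A + h \<in> {A..B} \<Longrightarrow> h < d \<Longrightarrow> z A \<sigma> < z (A + h) \<sigma>"
      by auto
    define h where "h = min (d / 2) (B - A)"
    have "0 < h" "h < d" "A + h \<in> {A..B}" using d(1) x0 by (auto simp: h_def)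
    with d(2)[of h] max[of "A + h" \<sigma>] eq \<sigma> show False by auto
  qed
  moreover have "\<xi> \<noteq> B"
  proof
    assume eq: "\<xi> = B"
    then have "((\<lambda>x. w x \<sigma>) has_real_derivative 0) (at B within {A..B})"
      using bdry[of B \<sigma>] \<sigma> \<sigma>0 wbig by auto
    then have "((\<lambda>x. z x \<sigma>) has_real_derivative 2 * M * (x0 - B)) (at B within {A..B})"
      unfolding z_def by (auto intro!: derivative_eq_intros simp: algebra_simps)
    from has_real_derivative_neg_dec_left[OF this] pos x0
    obtain d where d: "d > 0" "\<And>h. h > 0 \<Longrightarrow> B - h \<in> {A..B} \<Longrightarrow> h < d \<Longrightarrow> z B \<sigma> < z (B - h) \<sigma>"
      by (auto simp: mult_pos_neg)
    define h where "h = min (d / 2) (B - A)"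
    have "0 < h" "h < d" "B - h \<in> {A..B}" using d(1) x0 by (auto simp: h_def)
    with d(2)[of h] max[of "B - h" \<sigma>] eq \<sigma> show False by auto
  qed
  ultimately have \<xi>i: "A < \<xi>" "\<xi> < B" using \<xi> by auto
  have zx: "((\<lambda>x. z x \<sigma>) has_real_derivative wx y \<sigma> - 2 * M * (y - x0)) (at y)"
    if "y \<in> {A<..<B} - {0}" for y
    using int[OF that \<sigma>0] unfolding z_def
    by (auto intro!: derivative_eq_intros simp: algebra_simps)
  show False
  proof (cases "\<xi> = 0")
    case True
    then obtain p m where pm: "((\<lambda>x. wx x \<sigma>) \<longlongrightarrow> p) (at_right 0)"
       "((\<lambda>x. wx x \<sigma>) \<longlongrightarrow> m) (at_left 0)" "m < p"
      using jump[OF _ _ \<sigma>0] \<xi>i wpos by blast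
    \<comment> \<open>The barrier is smooth at the origin and shifts both one-sided slopes by the
      same amount, so \<open>z\<close> inherits the upward jump of \<open>w\<close>.\<close>
    have "p - 2 * M * (0 - x0) \<le> m - 2 * M * (0 - x0)"
    proof (rule local_max_one_sided_derivatives[where f = "\<lambda>x. z x \<sigma>" and A = A and B = B])
      show "continuous_on {A..B} (\<lambda>x. z x \<sigma>)"
        using continuous_on_compose2[OF contz, of "{A..B}" "\<lambda>x. (x, \<sigma>)"] \<sigma>0
        by (force intro!: continuous_intros)
      show "((\<lambda>y. wx y \<sigma> - 2 * M * (y - x0)) \<longlongrightarrow> p - 2 * M * (0 - x0)) (at_right 0)"
        by (intro tendsto_intros pm)
      show "((\<lambda>y. wx y \<sigma> - 2 * M * (y - x0)) \<longlongrightarrow> m - 2 * M * (0 - x0)) (at_left 0)"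
        by (intro tendsto_intros pm)
    qed (use True \<xi>i zx max \<sigma> in auto)
    with pm(3) show False by simp
  next
    case False
    then have \<xi>d: "\<xi> \<in> {A<..<B} - {0}" using \<xi>i by auto
    note i = int[OF \<xi>d \<sigma>0]
    have zt: "((\<lambda>s. z \<xi> s) has_real_derivative wt \<xi> \<sigma> - M * K) (at \<sigma>)"
      using i unfolding z_def by (auto intro!: derivative_eq_intros simp: algebra_simps)
    \<comment> \<open>The maximum may lie at the final time \<open>T\<close>, so only steps
      backwards in time are available. They yield this inequality rather than equality;
      \<open>\<sigma> > 0\<close> leaves room for them.\<close>
    have ut: "wt \<xi> \<sigma> - M * K \<ge> 0"
    proof (rule ccontr)
      assume "\<not> ?thesis"
      then obtain d where d: "d > 0" "\<And>h. h > 0 \<Longrightarrow> h < d \<Longrightarrow> z \<xi> \<sigma> < z \<xi> (\<sigma> - h)"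
        using has_real_derivative_neg_dec_left[OF zt] by auto
      define h where "h = min (d / 2) \<sigma>"
      have "0 < h" "h < d" "\<sigma> - h \<in> {0..T}" using d(1) \<sigma>0 \<sigma> by (auto simp: h_def)
      with d(2)[of h] max[of \<xi> "\<sigma> - h"] \<xi> show False by auto
    qed
    define d where "d = min \<bar>\<xi>\<bar> (min (\<xi> - A) (B - \<xi>))"
    have d: "d > 0" using \<xi>i False by (auto simp: d_def)
    have inside: "y \<in> {A<..<B} - {0}" if "\<bar>y - \<xi>\<bar> < d" for y
      using that unfolding d_def by auto
    have "wxx \<xi> \<sigma> - 2 * M \<le> 0"
    proof (rule local_max_second_derivative_nonpos[OF d])
      show "z y \<sigma> \<le> z \<xi> \<sigma>" if "\<bar>y - \<xi>\<bar> < d" for y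
        using max[of y \<sigma>] inside[OF that] \<sigma> by auto
      show "((\<lambda>x. z x \<sigma>) has_real_derivative wx y \<sigma> - 2 * M * (y - x0)) (at y)"
        if "\<bar>y - \<xi>\<bar> < d" for y using zx[OF inside[OF that]] .
      show "((\<lambda>y. wx y \<sigma> - 2 * M * (y - x0)) has_real_derivative wxx \<xi> \<sigma> - 2 * M) (at \<xi>)"
        using i by (auto intro!: derivative_eq_intros)
    qed
    \<comment> \<open>The bounds chain to c M K \<le> c \<open>wt\<close> \<le> D \<open>wxx\<close>
      \<le> 2 D M, against \<open>2 * D < c * K\<close>.\<close>
    then have "D * wxx \<xi> \<sigma> \<le> D * (2 * M)" using pos by simp
    moreover have "c * (M * K) \<le> c * wt \<xi> \<sigma>" using ut pos by simp
    moreover have "c * wt \<xi> \<sigma> \<le> D * wxx \<xi> \<sigma>" using i wpos by blast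
    moreover have "M * (2 * D) < M * (c * K)" using pos by simp
    ultimately show False by (simp add: algebra_simps)
  qed
qed

section \<open>Subsolutions obtained from solutions of the delta equation\<close>

lemma delta_solE:
  assumes "delta_sol c D k b J u"
  obtains ut ux uxx where
    "continuous_on (J \<times> {0..}) (\<lambda>(x, t). u x t)"
    "\<And>x t. x \<in> interior J - {0} \<Longrightarrow> t > 0 \<Longrightarrow>
           ((\<lambda>s. u x s) has_real_derivative ut x t) (at t) \<and>
           ((\<lambda>z. u z t) has_real_derivative ux x t) (at x) \<and>
           ((\<lambda>z. ux z t) has_real_derivative uxx x t) (at x) \<and>
           c * ut x t = D * uxx x t - k * (u x t - 1)"
    "\<And>t. t > 0 \<Longrightarrow> \<exists>p m. ((\<lambda>x. ux x t) \<longlongrightarrow> p) (at_right 0) \<and>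
           ((\<lambda>x. ux x t) \<longlongrightarrow> m) (at_left 0) \<and> D * (p - m) = 2 * b * u 0 t"
  using assms unfolding delta_sol_def by blast

lemma delta_solI:
  assumes "continuous_on (J \<times> {0..}) (\<lambda>(x, t). u x t)"
    and "\<And>x t. x \<noteq> 0 \<Longrightarrow> t > 0 \<Longrightarrow>
           ((\<lambda>s. u x s) has_real_derivative ut x t) (at t) \<and>
           ((\<lambda>z. u z t) has_real_derivative ux x t) (at x) \<and>
           ((\<lambda>z. ux z t) has_real_derivative uxx x t) (at x) \<and>
           c * ut x t = D * uxx x t - k * (u x t - 1)"
    and "\<And>t. t > 0 \<Longrightarrow> \<exists>p m. ((\<lambda>x. ux x t) \<longlongrightarrow> p) (at_right 0) \<and>
           ((\<lambda>x. ux x t) \<longlongrightarrow> m) (at_left 0) \<and> D * (p - m) = 2 * b * u 0 t"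
  shows "delta_sol c D k b J u"
  using assms unfolding delta_sol_def by blast

lemma greaterThanLessThan_subset_interior:
  "{A..B} \<subseteq> J \<Longrightarrow> {A<..<B :: real} \<subseteq> interior J"
  by (rule interior_maximal) auto

text \<open>Where \<open>s * u > h\<close>, the condition \<open>s \<le> h\<close> gives the term
  \<open>k * (s * u - s)\<close> a favourable sign, and \<open>0 \<le> h\<close> makes
  \<open>s * u\<close> positive at the origin, hence its slope jump positive. The second condition
  is asked only if 0 is an interior point, so that \<open>s = h = -1\<close> is allowed on windows
  off the origin.\<close>

lemma delta_sol_affine_sub_sol:
  assumes u: "delta_sol c D k b J u" and J: "{A..B} \<subseteq> J"
    and "D > 0" "k \<ge> 0" "b > 0" and sh: "s \<le> h" and h: "A < 0 \<Longrightarrow> 0 < B \<Longrightarrow> 0 \<le> h"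
  shows "sub_sol c D A B (\<lambda>x t. s * u x t - h)"
proof -
  obtain ut ux uxx where cont: "continuous_on (J \<times> {0..}) (\<lambda>(x, t). u x t)"
    and int: "\<And>x t. x \<in> interior J - {0} \<Longrightarrow> t > 0 \<Longrightarrow>
           ((\<lambda>s. u x s) has_real_derivative ut x t) (at t) \<and>
           ((\<lambda>z. u z t) has_real_derivative ux x t) (at x) \<and>
           ((\<lambda>z. ux z t) has_real_derivative uxx x t) (at x) \<and>
           c * ut x t = D * uxx x t - k * (u x t - 1)"
    and jump: "\<And>t. t > 0 \<Longrightarrow> \<exists>p m. ((\<lambda>x. ux x t) \<longlongrightarrow> p) (at_right 0) \<and>
           ((\<lambda>x. ux x t) \<longlongrightarrow> m) (at_left 0) \<and> D * (p - m) = 2 * b * u 0 t"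
    using delta_solE[OF u] by blast
  have "continuous_on ({A..B} \<times> {0..}) (\<lambda>(x, t). u x t)"
    by (rule continuous_on_subset[OF cont]) (use J in auto)
  then have "continuous_on ({A..B} \<times> {0..}) (\<lambda>(x, t). s * u x t - h)"
    unfolding split_def by (intro continuous_intros)
  moreover have "((\<lambda>r. s * u x r - h) has_real_derivative s * ut x t) (at t) \<and>
           ((\<lambda>z. s * u z t - h) has_real_derivative s * ux x t) (at x) \<and>
           ((\<lambda>z. s * ux z t) has_real_derivative s * uxx x t) (at x) \<and>
           (s * u x t - h > 0 \<longrightarrow> c * (s * ut x t) \<le> D * (s * uxx x t))"
    if x: "x \<in> {A<..<B} - {0}" and t: "t > 0" for x t
  proof -
    have i: "((\<lambda>s. u x s) has_real_derivative ut x t) (at t)"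
           "((\<lambda>z. u z t) has_real_derivative ux x t) (at x)"
           "((\<lambda>z. ux z t) has_real_derivative uxx x t) (at x)"
           "c * ut x t = D * uxx x t - k * (u x t - 1)"
      using int[of x t] x t greaterThanLessThan_subset_interior[OF J] by blast+
    have "c * (s * ut x t) \<le> D * (s * uxx x t)" if "s * u x t - h > 0"
    proof -
      have "0 \<le> k * (s * u x t - s)" using that sh \<open>k \<ge> 0\<close> by simp
      moreover have "c * (s * ut x t) = D * (s * uxx x t) - k * (s * u x t - s)"
        using arg_cong[OF i(4), of "\<lambda>q. s * q"] by (simp add: algebra_simps)
      ultimately show ?thesis by simp
    qed
    with i show ?thesis by (auto intro!: derivative_eq_intros)
  qed
  moreover have "\<exists>p m. ((\<lambda>x. s * ux x t) \<longlongrightarrow> p) (at_right 0) \<and>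
           ((\<lambda>x. s * ux x t) \<longlongrightarrow> m) (at_left 0) \<and> (s * u 0 t - h > 0 \<longrightarrow> m < p)"
    if AB: "A < 0" "0 < B" and t: "t > 0" for t
  proof -
    obtain p m where pm: "((\<lambda>x. ux x t) \<longlongrightarrow> p) (at_right 0)"
       "((\<lambda>x. ux x t) \<longlongrightarrow> m) (at_left 0)" "D * (p - m) = 2 * b * u 0 t"
      using jump[OF t] by blast
    have "s * m < s * p" if "s * u 0 t - h > 0"
    proof -
      have "0 < 2 * b * (s * u 0 t)" using that h[OF AB] \<open>b > 0\<close> by simp
      also have "\<dots> = D * (s * p - s * m)"
        using arg_cong[OF pm(3), of "\<lambda>q. s * q"] by (simp add: algebra_simps)
      finally show ?thesis using \<open>D > 0\<close> by (simp add: zero_less_mult_iff)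
    qed
    then show ?thesis
      by (intro exI[of _ "s * p"] exI[of _ "s * m"] conjI tendsto_intros pm) auto
  qed
  ultimately show ?thesis by (rule sub_solI)
qed

text \<open>The equation is affine in \<open>u\<close>: the constant 1 cancels in the difference,
  and both the damping \<open>k * (u - v)\<close> and the jump \<open>2 * b * (u - v)\<close> have
  the right sign where \<open>u > v\<close>.\<close>

lemma delta_sol_diff_sub_sol:
  assumes u: "delta_sol c D k b J u" and v: "delta_sol c D k b J v" and J: "{A..B} \<subseteq> J"
    and "D > 0" "k \<ge> 0" "b > 0"
  shows "sub_sol c D A B (\<lambda>x t. u x t - v x t)"
proof -
  obtain ut ux uxx where cont: "continuous_on (J \<times> {0..}) (\<lambda>(x, t). u x t)"
    and int: "\<And>x t. x \<in> interior J - {0} \<Longrightarrow> t > 0 \<Longrightarrow>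
           ((\<lambda>s. u x s) has_real_derivative ut x t) (at t) \<and>
           ((\<lambda>z. u z t) has_real_derivative ux x t) (at x) \<and>
           ((\<lambda>z. ux z t) has_real_derivative uxx x t) (at x) \<and>
           c * ut x t = D * uxx x t - k * (u x t - 1)"
    and jump: "\<And>t. t > 0 \<Longrightarrow> \<exists>p m. ((\<lambda>x. ux x t) \<longlongrightarrow> p) (at_right 0) \<and>
           ((\<lambda>x. ux x t) \<longlongrightarrow> m) (at_left 0) \<and> D * (p - m) = 2 * b * u 0 t"
    using delta_solE[OF u] by blast
  obtain vt vx vxx where cont': "continuous_on (J \<times> {0..}) (\<lambda>(x, t). v x t)"
    and int': "\<And>x t. x \<in> interior J - {0} \<Longrightarrow> t > 0 \<Longrightarrow>
           ((\<lambda>s. v x s) has_real_derivative vt x t) (at t) \<and>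
           ((\<lambda>z. v z t) has_real_derivative vx x t) (at x) \<and>
           ((\<lambda>z. vx z t) has_real_derivative vxx x t) (at x) \<and>
           c * vt x t = D * vxx x t - k * (v x t - 1)"
    and jump': "\<And>t. t > 0 \<Longrightarrow> \<exists>p m. ((\<lambda>x. vx x t) \<longlongrightarrow> p) (at_right 0) \<and>
           ((\<lambda>x. vx x t) \<longlongrightarrow> m) (at_left 0) \<and> D * (p - m) = 2 * b * v 0 t"
    using delta_solE[OF v] by blast
  have "continuous_on ({A..B} \<times> {0..}) (\<lambda>(x, t). u x t)"
       "continuous_on ({A..B} \<times> {0..}) (\<lambda>(x, t). v x t)"
    by (rule continuous_on_subset[OF cont] continuous_on_subset[OF cont']; use J in auto)+
  then have "continuous_on ({A..B} \<times> {0..}) (\<lambda>(x, t). u x t - v x t)"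
    unfolding split_def by (intro continuous_intros)
  moreover have "((\<lambda>r. u x r - v x r) has_real_derivative ut x t - vt x t) (at t) \<and>
           ((\<lambda>z. u z t - v z t) has_real_derivative ux x t - vx x t) (at x) \<and>
           ((\<lambda>z. ux z t - vx z t) has_real_derivative uxx x t - vxx x t) (at x) \<and>
           (u x t - v x t > 0 \<longrightarrow> c * (ut x t - vt x t) \<le> D * (uxx x t - vxx x t))"
    if x: "x \<in> {A<..<B} - {0}" and t: "t > 0" for x t
  proof -
    have x': "x \<in> interior J - {0}"
      using x greaterThanLessThan_subset_interior[OF J] by blast
    note i = int[OF x' t] int'[OF x' t]
    have "c * (ut x t - vt x t) \<le> D * (uxx x t - vxx x t)" if "u x t - v x t > 0"
    proof -
      have "0 \<le> k * (u x t - v x t)" using that \<open>k \<ge> 0\<close> by simp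
      moreover have "c * (ut x t - vt x t) = D * (uxx x t - vxx x t) - k * (u x t - v x t)"
        using i by (simp add: algebra_simps)
      ultimately show ?thesis by simp
    qed
    with i show ?thesis by (auto intro!: derivative_intros)
  qed
  moreover have "\<exists>p m. ((\<lambda>x. ux x t - vx x t) \<longlongrightarrow> p) (at_right 0) \<and>
           ((\<lambda>x. ux x t - vx x t) \<longlongrightarrow> m) (at_left 0) \<and> (u 0 t - v 0 t > 0 \<longrightarrow> m < p)"
    if t: "t > 0" for t
  proof -
    obtain p m where pm: "((\<lambda>x. ux x t) \<longlongrightarrow> p) (at_right 0)"
       "((\<lambda>x. ux x t) \<longlongrightarrow> m) (at_left 0)" "D * (p - m) = 2 * b * u 0 t"
      using jump[OF t] by blast
    obtain p' m' where pm': "((\<lambda>x. vx x t) \<longlongrightarrow> p') (at_right 0)"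
       "((\<lambda>x. vx x t) \<longlongrightarrow> m') (at_left 0)" "D * (p' - m') = 2 * b * v 0 t"
      using jump'[OF t] by blast
    have "m - m' < p - p'" if "u 0 t - v 0 t > 0"
    proof -
      have "0 < 2 * b * (u 0 t - v 0 t)" using that \<open>b > 0\<close> by simp
      also have "\<dots> = D * ((p - p') - (m - m'))"
        using pm(3) pm'(3) by (simp add: algebra_simps)
      finally show ?thesis using \<open>D > 0\<close> by (simp add: zero_less_mult_iff)
    qed
    then show ?thesis
      by (intro exI[of _ "p - p'"] exI[of _ "m - m'"] conjI tendsto_intros pm pm') auto
  qed
  ultimately show ?thesis by (rule sub_solI)
qed

text \<open>Brings \<open>V\<close> to the original space variable, where it can be subtracted from
  \<open>v \<epsilon>\<close>. Two space derivatives give 1/e^2, of which the diffusion coefficient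
  e absorbs one factor; in the jump the factors e and 1/e cancel, so \<open>b\<close> is
  unchanged.\<close>

lemma delta_sol_rescale:
  assumes u: "delta_sol c 1 k b UNIV u" and e: "e > 0"
  shows "delta_sol (c / e) e (k / e) b J (\<lambda>x t. u (x / e) t)"
proof -
  obtain ut ux uxx where cont: "continuous_on (UNIV \<times> {0..}) (\<lambda>(x, t). u x t)"
    and int: "\<And>x t. x \<in> interior UNIV - {0} \<Longrightarrow> t > 0 \<Longrightarrow>
           ((\<lambda>s. u x s) has_real_derivative ut x t) (at t) \<and>
           ((\<lambda>z. u z t) has_real_derivative ux x t) (at x) \<and>
           ((\<lambda>z. ux z t) has_real_derivative uxx x t) (at x) \<and>
           c * ut x t = 1 * uxx x t - k * (u x t - 1)"
    and jump: "\<And>t. t > 0 \<Longrightarrow> \<exists>p m. ((\<lambda>x. ux x t) \<longlongrightarrow> p) (at_right 0) \<and>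
           ((\<lambda>x. ux x t) \<longlongrightarrow> m) (at_left 0) \<and> 1 * (p - m) = 2 * b * u 0 t"
    using delta_solE[OF u] by blast
  have "continuous_on (J \<times> {0..}) (\<lambda>(x, t). u (x / e) t)"
    using continuous_on_compose2[OF cont, of "J \<times> {0..}" "\<lambda>q. (fst q / e, snd q)"] e
    by (force simp: split_def intro!: continuous_intros)
  moreover have "((\<lambda>s. u (x / e) s) has_real_derivative ut (x / e) t) (at t) \<and>
           ((\<lambda>z. u (z / e) t) has_real_derivative ux (x / e) t / e) (at x) \<and>
           ((\<lambda>z. ux (z / e) t / e) has_real_derivative uxx (x / e) t / e\<^sup>2) (at x) \<and>
           c / e * ut (x / e) t = e * (uxx (x / e) t / e\<^sup>2) - k / e * (u (x / e) t - 1)"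
    if x: "x \<noteq> 0" and t: "t > 0" for x t
  proof -
    have "x / e \<in> interior UNIV - {0}" using x e by simp
    note i = int[OF this t]
    have s: "((\<lambda>z. z / e) has_real_derivative 1 / e) (at x)"
      using e by (auto intro!: derivative_eq_intros)
    have "((\<lambda>z. u (z / e) t) has_real_derivative ux (x / e) t / e) (at x)"
      using DERIV_chain2[OF conjunct1[OF conjunct2[OF i]] s] by simp
    moreover have "((\<lambda>z. ux (z / e) t / e) has_real_derivative uxx (x / e) t / e\<^sup>2) (at x)"
      using DERIV_cdivide[OF DERIV_chain2[OF conjunct1[OF conjunct2[OF conjunct2[OF i]]] s], of e]
      by (simp add: power2_eq_square)
    moreover have "c / e * ut (x / e) t = e * (uxx (x / e) t / e\<^sup>2) - k / e * (u (x / e) t - 1)"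
      using i e by (simp add: field_simps power2_eq_square)
    ultimately show ?thesis using i by blast
  qed
  moreover have "\<exists>p m. ((\<lambda>x. ux (x / e) t / e) \<longlongrightarrow> p) (at_right 0) \<and>
           ((\<lambda>x. ux (x / e) t / e) \<longlongrightarrow> m) (at_left 0) \<and> e * (p - m) = 2 * b * u (0 / e) t"
    if t: "t > 0" for t
  proof -
    obtain p m where pm: "((\<lambda>x. ux x t) \<longlongrightarrow> p) (at_right 0)"
       "((\<lambda>x. ux x t) \<longlongrightarrow> m) (at_left 0)" "p - m = 2 * b * u 0 t"
      using jump[OF t] by auto
    have "filterlim (\<lambda>x. x / e) (at_right 0) (at_right 0)"
      using e by (auto simp: filterlim_at eventually_at_filter intro!: tendsto_eq_intros)
    moreover have "filterlim (\<lambda>x. x / e) (at_left 0) (at_left 0)"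
      using e by (auto simp: filterlim_at eventually_at_filter divide_neg_pos intro!: tendsto_eq_intros)
    ultimately have "((\<lambda>x. ux (x / e) t / e) \<longlongrightarrow> p / e) (at_right 0)"
        "((\<lambda>x. ux (x / e) t / e) \<longlongrightarrow> m / e) (at_left 0)"
      using e by (auto intro!: tendsto_intros filterlim_compose[OF pm(1)] filterlim_compose[OF pm(2)])
    moreover have "e * (p / e - m / e) = 2 * b * u (0 / e) t"
      using pm(3) e by (simp add: field_simps)
    ultimately show ?thesis by blast
  qed
  ultimately show ?thesis by (rule delta_solI)
qed

section \<open>Quantitative estimates in \<epsilon>\<close>

text \<open>With coefficient \<open>C / r\<^sup>2\<close> the barrier is at least \<open>C\<close>
  at distance \<open>r\<close> from \<open>x0\<close>, so an a priori bound replaces boundary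
  conditions. The 3 could be any number above 2, since c K = 3 e has to exceed 2 D = 2 e.\<close>

lemma sub_sol_le_local_barrier:
  assumes w: "sub_sol (\<tau> / e) e (x0 - r) (x0 + r) w"
    and pos: "\<tau> > 0" "e > 0" "r > 0" "C > 0" "N \<ge> 0"
    and init: "\<And>x. x \<in> {x0 - r..x0 + r} \<Longrightarrow> w x 0 \<le> N"
    and C: "\<And>x t. x \<in> {x0 - r..x0 + r} \<Longrightarrow> t \<in> {0..T} \<Longrightarrow> w x t \<le> C"
    and xt: "x \<in> {x0 - r..x0 + r}" "t \<in> {0..T}"
  shows "w x t \<le> N + C / r\<^sup>2 * ((x - x0)\<^sup>2 + 3 * e\<^sup>2 / \<tau> * t)"
proof (rule sub_sol_le_barrier[OF w])
  show "2 * e < \<tau> / e * (3 * e\<^sup>2 / \<tau>)"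
    using pos by (simp add: field_simps power2_eq_square)
  show "w x 0 \<le> N + C / r\<^sup>2 * (x - x0)\<^sup>2" if "x \<in> {x0 - r..x0 + r}" for x
    using init[OF that] pos by (smt (verit) divide_nonneg_nonneg mult_nonneg_nonneg zero_le_power2)
  show "w x t \<le> N + C / r\<^sup>2 * (x - x0)\<^sup>2 \<or>
      ((\<lambda>x. w x t) has_real_derivative 0) (at x within {x0 - r..x0 + r})"
    if "x \<in> {x0 - r, x0 + r}" "t \<in> {0<..T}" for x t
    using C[of x t] that pos by (auto simp: power2_eq_square)
qed (use assms in auto)

text \<open>The barrier is applied to \<open>u - M\<close> and \<open>- u - M\<close>, where
  \<open>M \<ge> 1\<close> puts the level above the equilibrium 1. The coefficient
  \<open>1 / L\<^sup>2\<close> makes its quadratic part at most 1, and \<open>e \<le> 1\<close>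
  frees the time part from \<open>e\<close>.\<close>

lemma delta_sol_neumann_bounded:
  assumes u: "delta_sol (\<tau> / e) e k b {-L..L} u" and bc: "neumann_bc L u"
    and pos: "\<tau> > 0" "e > 0" "e \<le> 1" "L > 0" "k \<ge> 0" "b > 0" "M \<ge> 1"
    and init: "\<And>x. x \<in> {-L..L} \<Longrightarrow> \<bar>u x 0\<bar> \<le> M"
    and xt: "x \<in> {-L..L}" "t \<in> {0..T}"
  shows "\<bar>u x t\<bar> \<le> M + 1 + 3 * T / (\<tau> * L\<^sup>2)"
proof -
  have "s * u x t - M \<le> 1 + 3 * T / (\<tau> * L\<^sup>2)" if s: "s \<in> {1, -1}" for s :: real
  proof -
    have "s * u x t - M \<le> 0 + 1 / L\<^sup>2 * ((x - 0)\<^sup>2 + 3 * e\<^sup>2 / \<tau> * t)"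
    proof (rule sub_sol_le_barrier)
      show "sub_sol (\<tau> / e) e (- L) L (\<lambda>x t. s * u x t - M)"
        using s pos by (intro delta_sol_affine_sub_sol[OF u]) auto
      show "2 * e < \<tau> / e * (3 * e\<^sup>2 / \<tau>)"
        using pos by (simp add: field_simps power2_eq_square)
      show "s * u x 0 - M \<le> 0 + 1 / L\<^sup>2 * (x - 0)\<^sup>2" if "x \<in> {-L..L}" for x
      proof -
        have "s * u x 0 - M \<le> 0" using init[OF that] s by auto
        also have "0 \<le> 0 + 1 / L\<^sup>2 * (x - 0)\<^sup>2" by simp
        finally show ?thesis .
      qed
      show "s * u x t - M \<le> 0 + 1 / L\<^sup>2 * (x - 0)\<^sup>2 \<or>
          ((\<lambda>x. s * u x t - M) has_real_derivative 0) (at x within {-L..L})"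
        if "x \<in> {-L, L}" "t \<in> {0<..T}" for x t
        using bc that unfolding neumann_bc_def by (auto intro!: derivative_eq_intros)
    qed (use pos xt in auto)
    also have "(x - 0)\<^sup>2 \<le> L\<^sup>2" using xt pos by (auto simp: abs_le_square_iff[symmetric])
    also have "3 * e\<^sup>2 / \<tau> * t \<le> 3 * 1 / \<tau> * T"
      using pos xt by (intro mult_mono divide_right_mono) (auto simp: power_le_one)
    finally show ?thesis using pos by (simp add: field_simps)
  qed
  from this[of 1] this[of "-1"] show ?thesis by auto
qed

text \<open>The rescaled \<open>V\<close> satisfies no Neumann condition at the end points, so only
  the bound \<open>C\<close> is used there. Centring at the origin reduces its effect to order e^2
  at points x = e y with y bounded.\<close>

lemma delta_sol_diff_le:
  assumes u: "delta_sol (\<tau> / e) e k b {-L..L} u" "delta_sol (\<tau> / e) e k b {-L..L} v"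
    and pos: "\<tau> > 0" "e > 0" "L > 0" "k \<ge> 0" "b > 0" "C > 0" "N \<ge> 0"
    and init: "\<And>x. x \<in> {-L..L} \<Longrightarrow> \<bar>u x 0 - v x 0\<bar> \<le> N"
    and C: "\<And>x t. x \<in> {-L..L} \<Longrightarrow> t \<in> {0..T} \<Longrightarrow> \<bar>u x t - v x t\<bar> \<le> C"
    and xt: "x \<in> {-L..L}" "t \<in> {0..T}"
  shows "\<bar>u x t - v x t\<bar> \<le> N + C / L\<^sup>2 * (x\<^sup>2 + 3 * e\<^sup>2 / \<tau> * t)"
proof -
  have sub: "sub_sol (\<tau> / e) e (0 - L) (0 + L) (\<lambda>x t. u x t - v x t)"
       "sub_sol (\<tau> / e) e (0 - L) (0 + L) (\<lambda>x t. v x t - u x t)"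
    using pos by (auto intro!: delta_sol_diff_sub_sol[OF u] delta_sol_diff_sub_sol[OF u(2,1)])
  have b1: "u x 0 - v x 0 \<le> N" "v x 0 - u x 0 \<le> N" if "x \<in> {0 - L..0 + L}" for x
    using init[of x] that by auto
  have b2: "u x t - v x t \<le> C" "v x t - u x t \<le> C" if "x \<in> {0 - L..0 + L}" "t \<in> {0..T}" for x t
    using C[of x t] that by auto
  have xt': "x \<in> {0 - L..0 + L}" using xt by simp
  show ?thesis
    using sub_sol_le_local_barrier[OF sub(1) pos(1,2,3,6,7) b1(1) b2(1) xt' xt(2)]
          sub_sol_le_local_barrier[OF sub(2) pos(1,2,3,6,7) b1(2) b2(2) xt' xt(2)]
    by (simp add: abs_le_iff)
qed

text \<open>The window around \<open>x0\<close> misses the origin because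
  \<open>2 * r \<le> \<bar>x0\<bar>\<close>, so the delta term is not seen and both signs of
  \<open>u - 1\<close> give subsolutions. The estimate is read off at the centre, where the
  quadratic part vanishes.\<close>

lemma delta_sol_diff_one_le:
  assumes u: "delta_sol (\<tau> / e) e k b {-L..L} u"
    and pos: "\<tau> > 0" "e > 0" "r > 0" "k \<ge> 0" "b > 0" "C > 0" "N \<ge> 0"
    and r: "2 * r \<le> \<bar>x0\<bar>" "r \<le> L - \<bar>x0\<bar>"
    and init: "\<And>x. \<bar>x - x0\<bar> \<le> r \<Longrightarrow> \<bar>u x 0 - 1\<bar> \<le> N"
    and C: "\<And>x t. x \<in> {-L..L} \<Longrightarrow> t \<in> {0..T} \<Longrightarrow> \<bar>u x t\<bar> \<le> C"
    and t: "t \<in> {0..T}"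
  shows "\<bar>u x0 t - 1\<bar> \<le> N + (C + 1) / r\<^sup>2 * (3 * e\<^sup>2 / \<tau> * t)"
proof -
  have "s * u x0 t - s \<le> N + (C + 1) / r\<^sup>2 * ((x0 - x0)\<^sup>2 + 3 * e\<^sup>2 / \<tau> * t)"
    if s: "s \<in> {1, -1}" for s :: real
  proof (rule sub_sol_le_local_barrier)
    show "sub_sol (\<tau> / e) e (x0 - r) (x0 + r) (\<lambda>x t. s * u x t - s)"
      using pos r by (intro delta_sol_affine_sub_sol[OF u]) auto
    show "s * u x 0 - s \<le> N" if "x \<in> {x0 - r..x0 + r}" for x
      using init[of x] that s by (auto simp: abs_le_iff)
    show "s * u x t - s \<le> C + 1" if "x \<in> {x0 - r..x0 + r}" "t \<in> {0..T}" for x t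
    proof -
      have "x \<in> {-L..L}" using that(1) r by auto
      then show ?thesis using C[of x t] that(2) s by (auto simp: abs_le_iff)
    qed
  qed (use pos t in auto)
  from this[of 1] this[of "-1"] show ?thesis by auto
qed

section \<open>Passage to the limit\<close>

text \<open>Convergence to 1 away from the origin is claimed from t = 0 on, where
  \<open>v \<epsilon> x 0\<close> differs from \<open>V0 (x / \<epsilon>)\<close> by at most the
  initial error. For fixed x \<noteq> 0 of either sign this forces \<open>V0\<close> to tend to 1 at
  both infinities, which is the premise of the second conjunct.\<close>

theorem lemma1p4:
  fixes L \<tau>1 a b :: real
    and V :: "real \<Rightarrow> real \<Rightarrow> real" and V0 :: "real \<Rightarrow> real"
    and v Ve :: "real \<Rightarrow> real \<Rightarrow> real \<Rightarrow> real" and v0 :: "real \<Rightarrow> real \<Rightarrow> real"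
  assumes "L > 0" and "\<tau>1 > 0" and "a \<ge> 0" and "b > 0"
    and V0_cont: "continuous_on UNIV V0" and V0_bdd: "bounded (range V0)"
    and V_sol: "delta_sol \<tau>1 1 (a\<^sup>2) b UNIV V"
    and V_bdd: "bounded ((\<lambda>(y, t). V y t) ` (UNIV \<times> {0..}))"
    and V_init: "\<And>y. V y 0 = V0 y"
    and v_sol: "\<And>\<epsilon>. \<epsilon> > 0 \<Longrightarrow> delta_sol (\<tau>1 / \<epsilon>) \<epsilon> (a\<^sup>2 / \<epsilon>) b {-L..L} (v \<epsilon>)"
    and v_bc: "\<And>\<epsilon>. \<epsilon> > 0 \<Longrightarrow> neumann_bc L (v \<epsilon>)"
    and v_init: "\<And>\<epsilon> x. \<epsilon> > 0 \<Longrightarrow> x \<in> {-L<..<L} \<Longrightarrow> v \<epsilon> x 0 = v0 \<epsilon> x"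
    and Ve: "\<And>\<epsilon> y t. \<epsilon> > 0 \<Longrightarrow> \<bar>y\<bar> \<le> L / \<epsilon> \<Longrightarrow> t \<ge> 0 \<Longrightarrow> Ve \<epsilon> y t = v \<epsilon> (\<epsilon> * y) t"
    and Ve_cont: "\<And>\<epsilon>. \<epsilon> > 0 \<Longrightarrow> continuous_on {-(L / \<epsilon>)..L / \<epsilon>} (\<lambda>y. Ve \<epsilon> y 0)"
    and Ve_init: "((\<lambda>\<epsilon>. SUP x \<in> {x. \<bar>x\<bar> \<le> L / \<epsilon>}. \<bar>Ve \<epsilon> x 0 - V0 x\<bar>) \<longlongrightarrow> 0) (at_right 0)"
  shows "locally_uniform_limit (UNIV \<times> {0..})
           (\<lambda>\<epsilon> (y, t). Ve \<epsilon> y t) (\<lambda>(y, t). V y t) (at_right 0) \<and>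
         ((V0 \<longlongrightarrow> 1) at_infinity \<longrightarrow>
           locally_uniform_limit (({-L<..<L} - {0}) \<times> {0..})
             (\<lambda>\<epsilon> (x, t). v \<epsilon> x t) (\<lambda>_. 1) (at_right 0)) \<and>
         locally_uniform_limit {0..} (\<lambda>\<epsilon> t. v \<epsilon> 0 t) (\<lambda>t. V 0 t) (at_right 0)"
proof -
  define E where "E = (\<lambda>\<epsilon>. SUP x \<in> {x. \<bar>x\<bar> \<le> L / \<epsilon>}. \<bar>Ve \<epsilon> x 0 - V0 x\<bar>)"
  have E0: "(E \<longlongrightarrow> 0) (at_right 0)" using Ve_init by (simp add: E_def)
  have E: "\<bar>v \<epsilon> x 0 - V0 (x / \<epsilon>)\<bar> \<le> E \<epsilon>" if "\<epsilon> > 0" "x \<in> {-L..L}" for \<epsilon> x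
  proof -
    have eq: "{x. \<bar>x\<bar> \<le> L / \<epsilon>} = {-(L / \<epsilon>)..L / \<epsilon>}" by auto
    \<comment> \<open>A real supremum bounds its set only if the set is bounded above; continuity on
      a compact interval provides this.\<close>
    have "compact ((\<lambda>x. \<bar>Ve \<epsilon> x 0 - V0 x\<bar>) ` {-(L / \<epsilon>)..L / \<epsilon>})"
      by (intro compact_continuous_image continuous_intros Ve_cont compact_Icc \<open>\<epsilon> > 0\<close>
          continuous_on_subset[OF V0_cont]) auto
    then have "bdd_above ((\<lambda>x. \<bar>Ve \<epsilon> x 0 - V0 x\<bar>) ` {x. \<bar>x\<bar> \<le> L / \<epsilon>})"
      unfolding eq by (intro bounded_imp_bdd_above compact_imp_bounded)
    moreover have "\<bar>x / \<epsilon>\<bar> \<le> L / \<epsilon>"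
      using that by (auto simp: abs_divide intro!: divide_right_mono)
    ultimately show ?thesis
      using cSUP_upper[of "x / \<epsilon>" "{x. \<bar>x\<bar> \<le> L / \<epsilon>}" "\<lambda>x. \<bar>Ve \<epsilon> x 0 - V0 x\<bar>"]
        Ve[of \<epsilon> "x / \<epsilon>" 0] that by (simp add: E_def)
  qed
  have Epos: "0 \<le> E \<epsilon>" if "\<epsilon> > 0" for \<epsilon>
    using E[OF that, of 0] \<open>L > 0\<close> by auto
  obtain C0 where C0: "C0 > 0" "\<And>y t. t \<ge> 0 \<Longrightarrow> \<bar>V y t\<bar> \<le> C0"
    using V_bdd unfolding bounded_pos by auto
  have \<epsilon>_pos: "\<forall>\<^sub>F \<epsilon> in at_right 0. \<epsilon> > (0 :: real)" by (rule eventually_at_right_less)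
  \<comment> \<open>Both limits rest on this estimate for a fixed time horizon. One constant bounds
    \<open>v \<epsilon>\<close> and its difference from the rescaled \<open>V\<close>.\<close>
  have key: "\<exists>C > 0. \<forall>\<^sub>F \<epsilon> in at_right 0. \<forall>x \<in> {-L..L}. \<forall>t \<in> {0..T}. \<bar>v \<epsilon> x t\<bar> \<le> C \<and>
      \<bar>v \<epsilon> x t - V (x / \<epsilon>) t\<bar> \<le> E \<epsilon> + C / L\<^sup>2 * (x\<^sup>2 + 3 * \<epsilon>\<^sup>2 / \<tau>1 * t)" if T: "T \<ge> 0" for T
  proof -
    \<comment> \<open>The Neumann bound with \<open>M = C0 + 1\<close>: initially
      \<open>v \<epsilon>\<close> is at most \<open>C0\<close> plus the initial error, which is
      eventually below 1.\<close>
    define C1 where "C1 = C0 + 1 + 1 + 3 * T / (\<tau>1 * L\<^sup>2)"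
    have C1: "C1 > 0" using C0 T \<open>\<tau>1 > 0\<close> by (simp add: C1_def add_pos_nonneg)
    have "\<forall>\<^sub>F \<epsilon> in at_right 0. \<epsilon> < (1::real)"
      using order_tendstoD(2)[OF tendsto_ident_at, of "0::real" 1 "{0<..}"] by simp
    moreover have "\<forall>\<^sub>F \<epsilon> in at_right 0. E \<epsilon> < 1"
      using order_tendstoD(2)[OF E0, of 1] by simp
    ultimately have "\<forall>\<^sub>F \<epsilon> in at_right 0. \<forall>x \<in> {-L..L}. \<forall>t \<in> {0..T}. \<bar>v \<epsilon> x t\<bar> \<le> C1 + C0 \<and>
      \<bar>v \<epsilon> x t - V (x / \<epsilon>) t\<bar> \<le> E \<epsilon> + (C1 + C0) / L\<^sup>2 * (x\<^sup>2 + 3 * \<epsilon>\<^sup>2 / \<tau>1 * t)"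
      using \<epsilon>_pos
    proof eventually_elim
      case (elim \<epsilon>)
      have k: "a\<^sup>2 / \<epsilon> \<ge> 0" using elim by simp
      have bd: "\<bar>v \<epsilon> x t\<bar> \<le> C1" if "x \<in> {-L..L}" "t \<in> {0..T}" for x t
        unfolding C1_def
      proof (rule delta_sol_neumann_bounded[OF v_sol v_bc])
        show "\<bar>v \<epsilon> x 0\<bar> \<le> C0 + 1" if "x \<in> {-L..L}" for x
          using E[OF elim(3) that] elim(2) C0(2)[of 0 "x / \<epsilon>"] V_init[of "x / \<epsilon>"] by auto
      qed (use elim assms(1-4) k that C0 in auto)
      have "\<bar>v \<epsilon> x t - V (x / \<epsilon>) t\<bar> \<le> E \<epsilon> + (C1 + C0) / L\<^sup>2 * (x\<^sup>2 + 3 * \<epsilon>\<^sup>2 / \<tau>1 * t)"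
        if "x \<in> {-L..L}" "t \<in> {0..T}" for x t
      proof (rule delta_sol_diff_le[OF v_sol delta_sol_rescale[OF V_sol], where T = T])
        show "\<bar>v \<epsilon> x 0 - V (x / \<epsilon>) 0\<bar> \<le> E \<epsilon>" if "x \<in> {-L..L}" for x
          using E[OF elim(3) that] V_init by simp
        show "\<bar>v \<epsilon> x t - V (x / \<epsilon>) t\<bar> \<le> C1 + C0" if "x \<in> {-L..L}" "t \<in> {0..T}" for x t
          using bd[OF that] C0(2)[of t "x / \<epsilon>"] that by auto
      qed (use elim assms(1-4) k that C0 C1 Epos in auto)
      with bd C0(1) show ?case by force
    qed
    with C0 C1 show ?thesis by (intro exI[of _ "C1 + C0"]) auto
  qed
  have inner: "\<forall>\<^sub>F \<epsilon> in at_right 0. \<forall>(y, t) \<in> K. dist (Ve \<epsilon> y t) (V y t) < \<delta>"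
    if K: "compact K" "K \<subseteq> UNIV \<times> {0..}" and \<delta>: "\<delta> > 0" for K \<delta>
  proof -
    \<comment> \<open>One radius serves both as the bound on \<open>y\<close> and as the time
      horizon.\<close>
    obtain Y where Y: "Y > 0" "\<And>p. p \<in> K \<Longrightarrow> norm p \<le> Y"
      using compact_imp_bounded[OF K(1)] unfolding bounded_pos by auto
    have KY: "\<bar>y\<bar> \<le> Y \<and> 0 \<le> t \<and> t \<le> Y" if "(y, t) \<in> K" for y t
      using Y(2)[OF that] norm_fst_le[of y t] norm_snd_le[of t y] K(2) that by auto
    obtain C where C: "C > 0" "\<forall>\<^sub>F \<epsilon> in at_right 0. \<forall>x \<in> {-L..L}. \<forall>t \<in> {0..Y}. \<bar>v \<epsilon> x t\<bar> \<le> C \<and>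
      \<bar>v \<epsilon> x t - V (x / \<epsilon>) t\<bar> \<le> E \<epsilon> + C / L\<^sup>2 * (x\<^sup>2 + 3 * \<epsilon>\<^sup>2 / \<tau>1 * t)"
      using key[of Y] Y(1) by auto
    \<comment> \<open>Eventually all of \<open>K\<close> lies over the rescaled interval, the only
      place where \<open>Ve\<close> is tied to \<open>v\<close>.\<close>
    have "((\<lambda>\<epsilon>. \<epsilon> * Y) \<longlongrightarrow> 0) (at_right 0)" by (auto intro!: tendsto_eq_intros)
    then have small: "\<forall>\<^sub>F \<epsilon> in at_right 0. \<epsilon> * Y < L"
      using order_tendstoD(2) \<open>L > 0\<close> by blast
    have "((\<lambda>\<epsilon>. E \<epsilon> + C / L\<^sup>2 * (\<epsilon>\<^sup>2 * Y\<^sup>2 + 3 * \<epsilon>\<^sup>2 / \<tau>1 * Y)) \<longlongrightarrow>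
        0 + C / L\<^sup>2 * (0\<^sup>2 * Y\<^sup>2 + 3 * 0\<^sup>2 / \<tau>1 * Y)) (at_right 0)"
      using \<open>\<tau>1 > 0\<close> by (intro tendsto_intros E0) auto
    then have "\<forall>\<^sub>F \<epsilon> in at_right 0. E \<epsilon> + C / L\<^sup>2 * (\<epsilon>\<^sup>2 * Y\<^sup>2 + 3 * \<epsilon>\<^sup>2 / \<tau>1 * Y) < \<delta>"
      by (rule order_tendstoD(2)) (use \<delta> in simp)
    with C(2) \<epsilon>_pos small show ?thesis
    proof eventually_elim
      case (elim \<epsilon>)
      have "dist (Ve \<epsilon> y t) (V y t) < \<delta>" if "(y, t) \<in> K" for y t
      proof -
        note yt = KY[OF that]
        have "\<epsilon> * \<bar>y\<bar> \<le> \<epsilon> * Y" using yt elim(2) by (intro mult_left_mono) auto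
        then have y: "\<epsilon> * \<bar>y\<bar> \<le> L" using elim(3) by linarith
        then have Vey: "Ve \<epsilon> y t = v \<epsilon> (\<epsilon> * y) t"
          using elim(2) yt by (intro Ve) (auto simp: field_simps)
        have "\<bar>\<epsilon> * y\<bar> \<le> L" using y elim(2) by (simp add: abs_mult)
        then have "\<epsilon> * y \<in> {-L..L}" by auto
        then have "\<bar>v \<epsilon> (\<epsilon> * y) t - V y t\<bar>
            \<le> E \<epsilon> + C / L\<^sup>2 * ((\<epsilon> * y)\<^sup>2 + 3 * \<epsilon>\<^sup>2 / \<tau>1 * t)"
          using elim(1,2) yt by fastforce
        also have "\<dots> \<le> E \<epsilon> + C / L\<^sup>2 * (\<epsilon>\<^sup>2 * Y\<^sup>2 + 3 * \<epsilon>\<^sup>2 / \<tau>1 * Y)"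
          using yt C(1) \<open>\<tau>1 > 0\<close> Y(1) unfolding power_mult_distrib
          by (intro add_mono mult_left_mono) (auto simp: abs_le_square_iff[symmetric])
        finally show ?thesis using elim(4) Vey by (simp add: dist_real_def)
      qed
      then show ?case by auto
    qed
  qed
  have outer: "\<forall>\<^sub>F \<epsilon> in at_right 0. \<forall>(x, t) \<in> K. dist (v \<epsilon> x t) 1 < \<delta>"
    if V1: "(V0 \<longlongrightarrow> 1) at_infinity" and K: "compact K" "K \<subseteq> ({-L<..<L} - {0}) \<times> {0..}"
      and \<delta>: "\<delta> > 0" for K \<delta>
  proof (cases "K = {}")
    case False
    obtain T where T: "T > 0" "\<And>p. p \<in> K \<Longrightarrow> norm p \<le> T"
      using compact_imp_bounded[OF K(1)] unfolding bounded_pos by auto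
    have KT: "t \<in> {0..T}" if "(x, t) \<in> K" for x t
      using T(2)[OF that] norm_snd_le[of t x] K(2) that by auto
    obtain C where C: "C > 0" "\<forall>\<^sub>F \<epsilon> in at_right 0. \<forall>x \<in> {-L..L}. \<forall>t \<in> {0..T}. \<bar>v \<epsilon> x t\<bar> \<le> C \<and>
      \<bar>v \<epsilon> x t - V (x / \<epsilon>) t\<bar> \<le> E \<epsilon> + C / L\<^sup>2 * (x\<^sup>2 + 3 * \<epsilon>\<^sup>2 / \<tau>1 * t)"
      using key[of T] T(1) by auto
    \<comment> \<open>Compactness gives one window radius for all points of \<open>K\<close>: at
      most half the distance to the origin and at most the distance to the end points.\<close>
    have "\<exists>p\<in>K. \<forall>q\<in>K. min (\<bar>fst p\<bar> / 2) (L - \<bar>fst p\<bar>) \<le> min (\<bar>fst q\<bar> / 2) (L - \<bar>fst q\<bar>)"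
      by (intro continuous_attains_inf K False continuous_intros) auto
    then obtain p where p: "p \<in> K"
      "\<And>q. q \<in> K \<Longrightarrow> min (\<bar>fst p\<bar> / 2) (L - \<bar>fst p\<bar>) \<le> min (\<bar>fst q\<bar> / 2) (L - \<bar>fst q\<bar>)"
      by blast
    define r where "r = min (\<bar>fst p\<bar> / 2) (L - \<bar>fst p\<bar>)"
    have r: "r > 0" using subsetD[OF K(2) p(1)] by (cases p) (auto simp: r_def)
    have Kr: "2 * r \<le> \<bar>x\<bar>" "r \<le> L - \<bar>x\<bar>" if "(x, t) \<in> K" for x t
      using p(2)[OF that] by (auto simp: r_def)
    obtain B where B: "\<And>y. B \<le> \<bar>y\<bar> \<Longrightarrow> \<bar>V0 y - 1\<bar> < \<delta> / 2"
      using tendstoD[OF V1, of "\<delta> / 2"] \<delta> unfolding eventually_at_infinity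
      by (auto simp: dist_real_def)
    have "((\<lambda>\<epsilon>. \<epsilon> * B) \<longlongrightarrow> 0) (at_right 0)" by (auto intro!: tendsto_eq_intros)
    then have small: "\<forall>\<^sub>F \<epsilon> in at_right 0. \<epsilon> * B < r"
      using order_tendstoD(2) r by blast
    have "((\<lambda>\<epsilon>. E \<epsilon> + (C + 1) / r\<^sup>2 * (3 * \<epsilon>\<^sup>2 / \<tau>1 * T)) \<longlongrightarrow>
        0 + (C + 1) / r\<^sup>2 * (3 * 0\<^sup>2 / \<tau>1 * T)) (at_right 0)"
      using \<open>\<tau>1 > 0\<close> by (intro tendsto_intros E0) auto
    then have "\<forall>\<^sub>F \<epsilon> in at_right 0. E \<epsilon> + (C + 1) / r\<^sup>2 * (3 * \<epsilon>\<^sup>2 / \<tau>1 * T) < \<delta> / 2"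
      by (rule order_tendstoD(2)) (use \<delta> in simp)
    with C(2) \<epsilon>_pos small show ?thesis
    proof eventually_elim
      case (elim \<epsilon>)
      have "dist (v \<epsilon> x0 t) 1 < \<delta>" if xt: "(x0, t) \<in> K" for x0 t
      proof -
        have "\<bar>v \<epsilon> x0 t - 1\<bar> \<le> (E \<epsilon> + \<delta> / 2) + (C + 1) / r\<^sup>2 * (3 * \<epsilon>\<^sup>2 / \<tau>1 * t)"
        proof (rule delta_sol_diff_one_le[OF v_sol])
          show "\<bar>v \<epsilon> x 0 - 1\<bar> \<le> E \<epsilon> + \<delta> / 2" if x: "\<bar>x - x0\<bar> \<le> r" for x
          proof -
            \<comment> \<open>A window point keeps distance \<open>2 * r - r\<close> from the
              origin, so \<open>\<epsilon> * B < r\<close> sends it beyond \<open>B\<close> after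
              rescaling, where \<open>V0\<close> is within \<open>\<delta> / 2\<close> of 1.\<close>
            have "r \<le> \<bar>x\<bar>" "x \<in> {-L..L}" using Kr[OF xt] x by auto
            moreover from this have "B \<le> \<bar>x / \<epsilon>\<bar>"
              using elim(2,3) by (simp add: abs_divide field_simps)
            ultimately show ?thesis
              using E[OF elim(2), of x] B[of "x / \<epsilon>"] by (smt (verit))
          qed
          show "\<bar>v \<epsilon> x t\<bar> \<le> C" if "x \<in> {-L..L}" "t \<in> {0..T}" for x t
            using elim(1) that by blast
        qed (use elim assms(1-4) r C(1) Epos \<delta> Kr[OF xt] KT[OF xt] in auto)
        also have "\<dots> \<le> (E \<epsilon> + \<delta> / 2) + (C + 1) / r\<^sup>2 * (3 * \<epsilon>\<^sup>2 / \<tau>1 * T)"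
          using KT[OF xt] C(1) \<open>\<tau>1 > 0\<close> by (intro add_mono mult_left_mono) auto
        finally show ?thesis using elim(4) by (simp add: dist_real_def)
      qed
      then show ?case by auto
    qed
  qed auto
  have "\<forall>\<^sub>F \<epsilon> in at_right 0. \<forall>t \<in> S. dist (v \<epsilon> 0 t) (V 0 t) < \<delta>"
    if S: "compact S" "S \<subseteq> {0..}" and \<delta>: "\<delta> > 0" for S \<delta>
  proof -
    \<comment> \<open>The third claim is the first one on the slice y = 0, a point unchanged by
      rescaling.\<close>
    have "\<forall>\<^sub>F \<epsilon> in at_right 0. \<forall>(y, t) \<in> {0} \<times> S. dist (Ve \<epsilon> y t) (V y t) < \<delta>"
      by (rule inner) (use S \<delta> in \<open>auto intro: compact_Times\<close>)
    with \<epsilon>_pos show ?thesis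
    proof eventually_elim
      case (elim \<epsilon>)
      have "Ve \<epsilon> 0 t = v \<epsilon> 0 t" if "t \<in> S" for t
        using Ve[of \<epsilon> 0 t] elim(1) \<open>L > 0\<close> S(2) that by auto
      with elim(2) show ?case by auto
    qed
  qed
  with inner outer show ?thesis
    unfolding locally_uniform_limit_def uniform_limit_iff by (simp add: split_def)
qed

end
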